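(* Let $\phi:[-1,1]\to\mathbb{R}$ be a convex, non-positive, non-constant, differentiable, Lipschitz function with Lipschitz constant $L(\phi)$. Given $\epsilon>0$, there exists a set $\mathcal{T}_\epsilon(\phi)\subset[-1,1]$ of size $O\big(\sqrt{L(\phi)/\epsilon}\,\log(L(\phi)/\epsilon)\big)$ such that $$0\le\phi(\rho)-\sup_{\rho_0\in\mathcal{T}_\epsilon(\phi)}h_{\rho_0}(\rho)\le2\epsilon\quad\text{for all }\rho\in[-1,1].$$
   Context: For $\gamma\ge0,t>0$ let $h_{\gamma,t}(\rho)=-\Big(\frac{1-\rho}{1+\rho}+\gamma^2\frac{1+\rho}{1-\rho}\Big)\frac{t^2}{2}$. For $\rho_0\in(-1,1)$ define $\gamma_0^2=\Big(\frac{1-\rho_0}{1+\rho_0}\Big)^2\frac{2\phi(\rho_0)+(1-\rho_0^2)\phi'(\rho_0)}{2\phi(\rho_0)-(1-\rho_0^2)\phi'(\rho_0)}$ and $t_0^2=-\frac12\frac{1+\rho_0}{1-\rho_0}\big[2\phi(\rho_0)-(1-\rho_0^2)\phi'(\rho_0)\big]$ (these are well defined with $\gamma_0^2\ge0$, $t_0^2>0$ under the hypotheses on $\phi$), and set $h_{\rho_0}:=h_{\gamma_0,t_0}$. For the boundary points define $h_{\pm1}(\rho)=-\frac{1\mp\rho}{1\pm\rho}\frac{t_{\pm1}^2}{2}+\phi(\pm1)$ with $t_{\pm1}^2=4\max\{\pm\phi'(\pm1),0\}$. $L(\phi)$ is the minimal Lipschitz constant of $\phi$.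
   Formalization: The constant in O(·) may depend, monotonically, on sup|φ|/L(φ), since an absolute constant fails for φ(ρ) = −M+ρ as M→∞; the size bound is stated for L(φ)/ε above an absolute threshold, and the set is only claimed finite below it. *)

theory Defs
  imports "HOL-Analysis.Analysis"
begin

definition lip_const :: "(real \<Rightarrow> real) \<Rightarrow> real" where
  "lip_const \<phi> = Inf {L. L-lipschitz_on {-1..1} \<phi>}"

text \<open>The derivative is one-sided at the end points.\<close>

definition dphi :: "(real \<Rightarrow> real) \<Rightarrow> real \<Rightarrow> real" where
  "dphi \<phi> \<rho> = vector_derivative \<phi> (at \<rho> within {-1..1})"

text \<open>
  The functions below are extended-real valued because they have poles at the end points of the
  interval. In \<^typ>\<open>ereal\<close> one has \<open>2 / 0 = \<infinity>\<close> and \<open>0 * \<infinity> = 0\<close>, so the value at a pole is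
  \<open>-\<infinity>\<close> if its coefficient is positive, and a term with coefficient \<open>0\<close> vanishes
  identically. The \<^typ>\<open>real\<close> convention \<open>2 / 0 = 0\<close> would give a wrong value there.
\<close>

definition h_gt :: "real \<Rightarrow> real \<Rightarrow> real \<Rightarrow> ereal" where
  "h_gt \<gamma> t \<rho> =
     - ((ereal (1 - \<rho>) / ereal (1 + \<rho>)
          + ereal (\<gamma>\<^sup>2) * (ereal (1 + \<rho>) / ereal (1 - \<rho>))) * ereal (t\<^sup>2 / 2))"

definition gamma0_sq :: "(real \<Rightarrow> real) \<Rightarrow> real \<Rightarrow> real" where
  "gamma0_sq \<phi> \<rho>\<^sub>0 =
     ((1 - \<rho>\<^sub>0) / (1 + \<rho>\<^sub>0))\<^sup>2 *
     ((2 * \<phi> \<rho>\<^sub>0 + (1 - \<rho>\<^sub>0\<^sup>2) * dphi \<phi> \<rho>\<^sub>0) / (2 * \<phi> \<rho>\<^sub>0 - (1 - \<rho>\<^sub>0\<^sup>2) * dphi \<phi> \<rho>\<^sub>0))"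

definition t0_sq :: "(real \<Rightarrow> real) \<Rightarrow> real \<Rightarrow> real" where
  "t0_sq \<phi> \<rho>\<^sub>0 =
     - (1 / 2) * ((1 + \<rho>\<^sub>0) / (1 - \<rho>\<^sub>0)) * (2 * \<phi> \<rho>\<^sub>0 - (1 - \<rho>\<^sub>0\<^sup>2) * dphi \<phi> \<rho>\<^sub>0)"

definition h_plus1 :: "(real \<Rightarrow> real) \<Rightarrow> real \<Rightarrow> ereal" where
  "h_plus1 \<phi> \<rho> =
     - ((ereal (1 - \<rho>) / ereal (1 + \<rho>)) * ereal (4 * max (dphi \<phi> 1) 0 / 2)) + ereal (\<phi> 1)"

definition h_minus1 :: "(real \<Rightarrow> real) \<Rightarrow> real \<Rightarrow> ereal" where
  "h_minus1 \<phi> \<rho> =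
     - ((ereal (1 + \<rho>) / ereal (1 - \<rho>)) * ereal (4 * max (- dphi \<phi> (-1)) 0 / 2)) + ereal (\<phi> (-1))"

definition h_at :: "(real \<Rightarrow> real) \<Rightarrow> real \<Rightarrow> real \<Rightarrow> ereal" where
  "h_at \<phi> \<rho>\<^sub>0 =
     (if \<rho>\<^sub>0 = 1 then h_plus1 \<phi>
      else if \<rho>\<^sub>0 = -1 then h_minus1 \<phi>
      else h_gt (sqrt (gamma0_sq \<phi> \<rho>\<^sub>0)) (sqrt (t0_sq \<phi> \<rho>\<^sub>0)))"

end

theory Submission
  imports Defs
begin

text \<open>
  In the coordinate \<open>u = artanh \<rho>\<close>, the function \<open>h\<close> at the interior point \<open>tanh v\<close> is the
  combination of \<open>cosh (2 (u - v))\<close> and \<open>sinh (2 (u - v))\<close> that agrees with \<open>\<phi> \<circ> tanh\<close> to first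
  order at \<open>v\<close>. It lies below the tangent of \<open>\<phi>\<close> at \<open>tanh v\<close> by \<open>(sinh (u - v))\<^sup>2\<close> times a factor
  that is nonnegative because \<open>\<phi>(\<plusminus>1) \<le> 0\<close>, and at most \<open>2 M + L\<close> with \<open>M = sup |\<phi>|\<close>. By
  convexity, \<open>\<phi>\<close> exceeds this tangent at \<open>tanh u\<close> by at most \<open>|u - v|\<close> times the change of \<open>\<phi>'\<close>
  between the two points. Hence it suffices that every \<open>u\<close> has a \<open>v\<close> in the set with
  \<open>|u - v| \<le> \<delta>\<close> and with values of \<open>\<phi>'\<close> that differ by at most \<open>\<epsilon> / \<delta>\<close>, where
  \<open>4 \<delta>\<^sup>2 (2 M + L) = \<epsilon>\<close>. As \<open>u\<close> and \<open>\<phi>'(tanh u)\<close> both increase with \<open>u\<close>, a net for the sum of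
  \<open>u / \<delta>\<close> and \<open>\<phi>'(tanh u) \<delta> / \<epsilon>\<close> serves both. The points with \<open>|u| > ln (L / \<epsilon>)\<close> are so
  close to \<open>\<plusminus>1\<close> that the functions \<open>h\<close> at the end points approximate \<open>\<phi>\<close> there.
\<close>

subsection \<open>Convex and Lipschitz functions\<close>

lemma has_derivative_within_directional:
  fixes f :: "'a::real_normed_vector \<Rightarrow> real"
  assumes f: "(f has_derivative f') (at c within A)"
    and A: "convex A" "c \<in> A" "y \<in> A"
  shows "((\<lambda>t. (f ((1 - t) *\<^sub>R c + t *\<^sub>R y) - f c) / t) \<longlongrightarrow> f' (y - c)) (at_right 0)"
proof -
  define g where "g t = (1 - t) *\<^sub>R c + t *\<^sub>R y" for t
  have "(g has_vector_derivative (y - c)) (at 0 within {0..1})"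
    unfolding g_def by (auto intro!: derivative_eq_intros)
  moreover have "g ` {0..1} \<subseteq> A"
    using convexD_alt[OF A] by (auto simp: g_def)
  then have "(f has_derivative f') (at (g 0) within g ` {0..1})"
    using has_derivative_subset[OF f] by (simp add: g_def)
  ultimately have "((f \<circ> g) has_vector_derivative f' (y - c)) (at 0 within {0..1})"
    by (rule vector_derivative_diff_chain_within)
  then show ?thesis
    by (simp add: g_def has_field_derivative_iff at_within_Icc_at_right
        flip: has_real_derivative_iff_has_vector_derivative)
qed

text \<open>Unlike in \<open>convex_on_imp_above_tangent\<close>, the point \<open>c\<close> may lie on the boundary of \<open>A\<close>.\<close>

lemma convex_on_imp_above_tangent_within:
  fixes f :: "'a::real_normed_vector \<Rightarrow> real"
  assumes f: "convex_on A f" "(f has_derivative f') (at c within A)" and A: "c \<in> A" "y \<in> A"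
  shows "f c + f' (y - c) \<le> f y"
proof -
  have "f' (y - c) \<le> f y - f c"
  proof (rule tendsto_upperbound)
    show "((\<lambda>t. (f ((1 - t) *\<^sub>R c + t *\<^sub>R y) - f c) / t) \<longlongrightarrow> f' (y - c)) (at_right 0)"
      using has_derivative_within_directional[OF f(2) convex_on_imp_convex[OF f(1)] A] .
    have "(f ((1 - t) *\<^sub>R c + t *\<^sub>R y) - f c) / t \<le> f y - f c" if "0 < t" "t < 1" for t
      using convex_onD[OF f(1), of t c y] A that by (simp add: field_simps)
    then show "\<forall>\<^sub>F t in at_right 0. (f ((1 - t) *\<^sub>R c + t *\<^sub>R y) - f c) / t \<le> f y - f c"
      by (intro eventually_at_rightI[of 0 1]) auto
  qed simp
  then show ?thesis by simp
qed

lemma lipschitz_on_has_derivative_le: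
  fixes f :: "'a::real_normed_vector \<Rightarrow> real"
  assumes f: "L-lipschitz_on A f" "(f has_derivative f') (at c within A)"
    and A: "convex A" "c \<in> A" "y \<in> A"
  shows "\<bar>f' (y - c)\<bar> \<le> L * norm (y - c)"
proof (rule tendsto_upperbound)
  show "((\<lambda>t. \<bar>(f ((1 - t) *\<^sub>R c + t *\<^sub>R y) - f c) / t\<bar>) \<longlongrightarrow> \<bar>f' (y - c)\<bar>) (at_right 0)"
    using has_derivative_within_directional[OF f(2) A] by (rule tendsto_rabs)
  have "\<bar>(f ((1 - t) *\<^sub>R c + t *\<^sub>R y) - f c) / t\<bar> \<le> L * norm (y - c)" if "0 < t" "t < 1" for t
  proof -
    have "(1 - t) *\<^sub>R c + t *\<^sub>R y - c = t *\<^sub>R (y - c)"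
      by (simp add: algebra_simps)
    then have "\<bar>f ((1 - t) *\<^sub>R c + t *\<^sub>R y) - f c\<bar> \<le> L * (t * norm (y - c))"
      using lipschitz_on_normD[OF f(1) convexD_alt[OF A] A(2), of t] that by simp
    then show ?thesis
      using that by (simp add: abs_divide field_simps)
  qed
  then show "\<forall>\<^sub>F t in at_right 0.
      \<bar>(f ((1 - t) *\<^sub>R c + t *\<^sub>R y) - f c) / t\<bar> \<le> L * norm (y - c)"
    by (intro eventually_at_rightI[of 0 1]) auto
qed simp

lemma convex_on_imp_mono_on_derivative:
  fixes f :: "real \<Rightarrow> real"
  assumes f: "convex_on A f" "\<And>x. x \<in> A \<Longrightarrow> (f has_real_derivative f' x) (at x within A)"
  shows "mono_on A f'"
proof (rule mono_onI)
  fix x y assume xy: "x \<in> A" "y \<in> A" "x \<le> y"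
  have "f x + f' x * (y - x) \<le> f y" "f y + f' y * (x - y) \<le> f x"
    using convex_on_imp_above_tangent_within[OF f(1) f(2)[unfolded has_field_derivative_def]] xy
    by blast+
  then have "f' x * (y - x) \<le> f' y * (y - x)"
    by (simp add: algebra_simps)
  then show "f' x \<le> f' y"
    using xy(3) by (cases "x = y") auto
qed

lemma lipschitz_on_Inf:
  fixes f :: "'a::metric_space \<Rightarrow> 'b::metric_space"
  assumes "\<exists>L. L-lipschitz_on A f"
  shows "(Inf {L. L-lipschitz_on A f})-lipschitz_on A f"
proof (rule lipschitz_onI)
  have nonempty: "{L. L-lipschitz_on A f} \<noteq> {}"
    using assms by simp
  show "0 \<le> Inf {L. L-lipschitz_on A f}"
    by (rule cInf_greatest[OF nonempty]) (auto dest: lipschitz_on_nonneg)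
  show "dist (f x) (f y) \<le> Inf {L. L-lipschitz_on A f} * dist x y" if "x \<in> A" "y \<in> A" for x y
  proof (cases "x = y")
    case False
    have "dist (f x) (f y) / dist x y \<le> Inf {L. L-lipschitz_on A f}"
      by (rule cInf_greatest[OF nonempty])
        (use that False in \<open>auto simp: lipschitz_on_def divide_simps\<close>)
    then show ?thesis
      using False by (simp add: divide_simps)
  qed simp
qed

subsection \<open>Finite nets and suprema\<close>

lemma finite_unit_net:
  fixes h :: "'a \<Rightarrow> real"
  assumes range: "\<And>x. x \<in> S \<Longrightarrow> h x \<in> {a..b}" and "a \<le> b"
  obtains T where "T \<subseteq> S" "finite T" "real (card T) \<le> b - a + 1"
    "\<And>x. x \<in> S \<Longrightarrow> \<exists>y\<in>T. \<bar>h x - h y\<bar> < 1"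
proof -
  define cell where "cell x = \<lfloor>h x - a\<rfloor>" for x
  have cells: "cell ` S \<subseteq> {0..\<lfloor>b - a\<rfloor>}"
    using range unfolding cell_def by (auto intro!: floor_mono)
  obtain T where T: "T \<subseteq> S" "inj_on cell T" "cell ` S = cell ` T"
    using subset_image_inj[of "cell ` S" cell S] by auto
  show ?thesis
  proof
    show "T \<subseteq> S" by (rule T(1))
    have "finite (cell ` T)"
      using cells finite_subset unfolding T(3) by blast
    then show "finite T"
      using T(2) by (rule finite_imageD)
    have "card T \<le> nat (\<lfloor>b - a\<rfloor> + 1)"
      using card_mono[OF _ cells] card_image[OF T(2)] unfolding T(3) by simp
    then show "real (card T) \<le> b - a + 1"
      using \<open>a \<le> b\<close> by linarith
    fix x assume "x \<in> S"
    then obtain y where "y \<in> T" "cell x = cell y"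
      using T(3) by blast
    then have "\<bar>h x - h y\<bar> < 1"
      unfolding cell_def by linarith
    then show "\<exists>y\<in>T. \<bar>h x - h y\<bar> < 1"
      using \<open>y \<in> T\<close> by blast
  qed
qed

lemma abs_diff_le_of_scaled_sum_mono_on:
  fixes f g :: "'a::linorder \<Rightarrow> real"
  assumes mono: "mono_on S f" "mono_on S g" and pos: "0 < \<delta>" "0 < \<eta>"
    and "x \<in> S" "y \<in> S" "\<bar>f x / \<delta> + g x / \<eta> - (f y / \<delta> + g y / \<eta>)\<bar> \<le> 1"
  shows "\<bar>f x - f y\<bar> \<le> \<delta> \<and> \<bar>g x - g y\<bar> \<le> \<eta>"
  using assms(5-)
proof (induction x y rule: linorder_wlog)
  case (le x y)
  then have le_y: "f x \<le> f y" "g x \<le> g y"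
    using mono_onD[OF mono(1)] mono_onD[OF mono(2)] by auto
  then have "0 \<le> (f y - f x) / \<delta>" "0 \<le> (g y - g x) / \<eta>"
    using pos by auto
  moreover have "(f y - f x) / \<delta> + (g y - g x) / \<eta> \<le> 1"
    using le.prems(3) by (simp add: diff_divide_distrib)
  ultimately have "(f y - f x) / \<delta> \<le> 1" "(g y - g x) / \<eta> \<le> 1"
    by linarith+
  then show ?case
    using pos le_y by (simp add: pos_divide_le_eq)
next
  case (sym x y)
  then show ?case
    by (simp add: abs_minus_commute)
qed

lemma finite_net_mono_on:
  fixes f g :: "'a::linorder \<Rightarrow> real"
  assumes f: "mono_on S f" "\<And>x. x \<in> S \<Longrightarrow> f x \<in> {a..b}" "a \<le> b"
    and g: "mono_on S g" "\<And>x. x \<in> S \<Longrightarrow> g x \<in> {c..d}" "c \<le> d"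
    and pos: "0 < \<delta>" "0 < \<eta>"
  obtains T where "T \<subseteq> S" "finite T" "real (card T) \<le> (b - a) / \<delta> + (d - c) / \<eta> + 1"
    "\<And>x. x \<in> S \<Longrightarrow> \<exists>y\<in>T. \<bar>f x - f y\<bar> \<le> \<delta> \<and> \<bar>g x - g y\<bar> \<le> \<eta>"
proof -
  define h where "h x = f x / \<delta> + g x / \<eta>" for x
  obtain T where T: "T \<subseteq> S" "finite T" "real (card T) \<le> b / \<delta> + d / \<eta> - (a / \<delta> + c / \<eta>) + 1"
    "\<And>x. x \<in> S \<Longrightarrow> \<exists>y\<in>T. \<bar>h x - h y\<bar> < 1"
  proof (rule finite_unit_net[where h = h])
    show "h x \<in> {a / \<delta> + c / \<eta> .. b / \<delta> + d / \<eta>}" if "x \<in> S" for x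
      using f(2)[OF that] g(2)[OF that] pos unfolding h_def
      by (auto intro!: add_mono divide_right_mono)
    show "a / \<delta> + c / \<eta> \<le> b / \<delta> + d / \<eta>"
      using f(3) g(3) pos by (intro add_mono divide_right_mono) auto
  qed (rule that)
  show ?thesis
  proof
    show "real (card T) \<le> (b - a) / \<delta> + (d - c) / \<eta> + 1"
      using T(3) by (simp add: diff_divide_distrib)
    fix x assume "x \<in> S"
    then obtain y where "y \<in> T" "\<bar>h x - h y\<bar> < 1"
      using T(4) by blast
    moreover have "y \<in> S"
      using T(1) \<open>y \<in> T\<close> by blast
    ultimately have "\<bar>f x - f y\<bar> \<le> \<delta> \<and> \<bar>g x - g y\<bar> \<le> \<eta>"
      using abs_diff_le_of_scaled_sum_mono_on[OF f(1) g(1) pos \<open>x \<in> S\<close>] unfolding h_def by simp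
    then show "\<exists>y\<in>T. \<bar>f x - f y\<bar> \<le> \<delta> \<and> \<bar>g x - g y\<bar> \<le> \<eta>"
      using \<open>y \<in> T\<close> by blast
  qed (use T in auto)
qed

lemma ereal_minus_SUP_bounds:
  fixes g :: "'a \<Rightarrow> ereal"
  assumes upper: "\<And>s. s \<in> T \<Longrightarrow> g s \<le> ereal a" and lower: "\<exists>s\<in>T. ereal (a - b) \<le> g s"
  shows "0 \<le> ereal a - (SUP s\<in>T. g s)" "ereal a - (SUP s\<in>T. g s) \<le> ereal b"
proof -
  show "0 \<le> ereal a - (SUP s\<in>T. g s)"
    by (intro ereal_diff_positive SUP_least upper)
  have "ereal (a - b) \<le> (SUP s\<in>T. g s)"
    using lower by (auto intro: SUP_upper2)
  then have "ereal a - (SUP s\<in>T. g s) \<le> ereal a - ereal (a - b)"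
    by (intro ereal_minus_mono) auto
  then show "ereal a - (SUP s\<in>T. g s) \<le> ereal b" by simp
qed

subsection \<open>Hyperbolic functions\<close>

lemma tanh_real_in_Icc: "tanh u \<in> {-1..1}" for u :: real
  using tanh_real_bounds[of u] by auto

lemma abs_sinh_le_double:
  fixes x :: real
  assumes "\<bar>x\<bar> \<le> 1"
  shows "\<bar>sinh x\<bar> \<le> 2 * \<bar>x\<bar>"
proof -
  define y where "y = \<bar>x\<bar>"
  have y: "0 \<le> y" "y \<le> 1"
    using assms unfolding y_def by auto
  have "exp y \<le> 1 + y + y\<^sup>2" "1 - y \<le> exp (- y)" "y\<^sup>2 \<le> y"
    using y exp_bound exp_ge_add_one_self[of "- y"] power_decreasing[of 1 2 y] by auto
  then have "sinh y \<le> 2 * y"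
    using y unfolding sinh_field_def by simp
  then show ?thesis
    unfolding y_def by simp
qed

lemma abs_tanh_diff_le: "\<bar>tanh u - tanh v\<bar> \<le> \<bar>u - v\<bar>" for u v :: real
proof -
  have "norm (tanh u - tanh v) \<le> 1 * norm (u - v)"
  proof (rule field_differentiable_bound[where S = UNIV])
    show "(tanh has_field_derivative 1 - (tanh z)\<^sup>2) (at z within UNIV)" for z :: real
      by (auto intro!: derivative_eq_intros)
    show "norm (1 - (tanh z)\<^sup>2) \<le> 1" for z :: real
      using tanh_real_bounds[of z] by (simp add: abs_square_le_1 abs_le_iff)
  qed auto
  then show ?thesis by simp
qed

lemma tanh_artanh_real:
  fixes x :: real
  assumes "\<bar>x\<bar> < 1"
  shows "tanh (artanh x) = x"
proof -
  define q where "q = (1 + x) / (1 - x)"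
  have "0 < q"
    using assms unfolding q_def by auto
  then have "artanh x = ln (sqrt q)"
    by (simp add: artanh_def ln_sqrt flip: q_def)
  then have "tanh (artanh x) = (q - 1) / (q + 1)"
    using \<open>0 < q\<close> by (simp add: tanh_ln_real)
  also have "\<dots> = x"
    using assms unfolding q_def by (simp add: field_simps)
  finally show ?thesis .
qed

lemma one_plus_tanh_div_one_minus_tanh: "(1 + tanh u) / (1 - tanh u) = exp (2 * u)" for u :: real
proof -
  have "(1 + tanh u) / (1 - tanh u) = (cosh u + sinh u) / (cosh u - sinh u)"
    by (simp add: tanh_def field_split_simps)
  also have "\<dots> = exp (2 * u)"
    by (simp add: cosh_plus_sinh cosh_minus_sinh flip: exp_diff)
  finally show ?thesis .
qed

lemma one_minus_tanh_ln: "0 < x \<Longrightarrow> 1 - tanh (ln x) = 2 / (x\<^sup>2 + 1)" for x :: real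
  by (simp add: tanh_ln_real field_simps add_nonneg_eq_0_iff)

lemma tanh_tangent_identity:
  fixes a p u v :: real
  defines "b \<equiv> (1 - (tanh v)\<^sup>2) * p"
  shows "a * cosh (2 * (u - v)) + b / 2 * sinh (2 * (u - v))
    = a + p * (tanh u - tanh v) - (sinh (u - v))\<^sup>2 * (- 2 * a - tanh u * b)"
proof -
  define d where "d = u - v"
  have sech: "1 - (tanh v)\<^sup>2 = 1 / (cosh v)\<^sup>2"
    by (simp add: tanh_def power_divide sinh_square_eq diff_divide_distrib)
  have tanh_diff: "tanh u - tanh v = sinh d / (cosh u * cosh v)"
    by (simp add: d_def sinh_diff tanh_def field_simps)
  have "cosh v = cosh u * cosh d - sinh u * sinh d"
    using cosh_diff[of u d] by (simp add: d_def)
  then have "cosh d = cosh v / cosh u + sinh d * tanh u"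
    by (simp add: tanh_def field_simps)
  then have "sinh d * cosh d = sinh d * cosh v / cosh u + (sinh d)\<^sup>2 * tanh u"
    by (simp add: algebra_simps power2_eq_square)
  moreover have "p * (tanh u - tanh v) = b * (sinh d * cosh v / cosh u)"
    unfolding tanh_diff b_def sech by (simp add: power2_eq_square)
  moreover have "a * cosh (2 * d) = a + 2 * a * (sinh d)\<^sup>2"
    unfolding cosh_double cosh_square_eq by (simp add: algebra_simps)
  ultimately show ?thesis
    unfolding d_def[symmetric] sinh_double by (simp add: algebra_simps)
qed

subsection \<open>The comparison functions\<close>

text \<open>The derivative of \<open>\<phi> \<circ> tanh\<close> at \<open>artanh s\<close>.\<close>

definition tanh_deriv :: "(real \<Rightarrow> real) \<Rightarrow> real \<Rightarrow> real" where
  "tanh_deriv \<phi> s = (1 - s\<^sup>2) * dphi \<phi> s"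

lemma t0_sq_tanh:
  "t0_sq \<phi> (tanh v) = exp (2 * v) * (tanh_deriv \<phi> (tanh v) / 2 - \<phi> (tanh v))"
  by (simp add: t0_sq_def one_plus_tanh_div_one_minus_tanh tanh_deriv_def algebra_simps)

lemma gamma0_sq_tanh:
  "gamma0_sq \<phi> (tanh v) = (exp (- 2 * v))\<^sup>2 *
    ((2 * \<phi> (tanh v) + tanh_deriv \<phi> (tanh v)) / (2 * \<phi> (tanh v) - tanh_deriv \<phi> (tanh v)))"
  using one_plus_tanh_div_one_minus_tanh[of "- v"] by (simp add: gamma0_sq_def tanh_deriv_def)

context
  fixes \<phi> :: "real \<Rightarrow> real" and v :: real
  assumes slope: "\<bar>tanh_deriv \<phi> (tanh v)\<bar> < - 2 * \<phi> (tanh v)"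
begin

lemma t0_sq_tanh_pos: "0 < t0_sq \<phi> (tanh v)"
  using slope by (simp add: t0_sq_tanh)

lemma gamma0_sq_tanh_pos: "0 < gamma0_sq \<phi> (tanh v)"
  unfolding gamma0_sq_tanh using slope by (intro mult_pos_pos divide_neg_neg) auto

lemma gamma0_sq_times_t0_sq_tanh:
  "gamma0_sq \<phi> (tanh v) * t0_sq \<phi> (tanh v)
    = - exp (- 2 * v) * (tanh_deriv \<phi> (tanh v) / 2 + \<phi> (tanh v))"
proof -
  define P N where "P = 2 * \<phi> (tanh v) + tanh_deriv \<phi> (tanh v)"
    and "N = 2 * \<phi> (tanh v) - tanh_deriv \<phi> (tanh v)"
  have "N \<noteq> 0"
    using slope unfolding N_def by linarith
  have "tanh_deriv \<phi> (tanh v) / 2 - \<phi> (tanh v) = - N / 2"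
    unfolding N_def by simp
  then have "gamma0_sq \<phi> (tanh v) * t0_sq \<phi> (tanh v)
      = (exp (- 2 * v))\<^sup>2 * (P / N) * (exp (2 * v) * (- N / 2))"
    by (simp only: gamma0_sq_tanh t0_sq_tanh P_def N_def)
  also have "\<dots> = - exp (- 2 * v) * (P / 2)"
    using \<open>N \<noteq> 0\<close> by (simp add: exp_minus field_simps power2_eq_square)
  finally show ?thesis
    unfolding P_def by (simp add: algebra_simps)
qed

lemma h_at_tanh:
  "h_at \<phi> (tanh v) (tanh u)
    = ereal (\<phi> (tanh v) * cosh (2 * (u - v)) + tanh_deriv \<phi> (tanh v) / 2 * sinh (2 * (u - v)))"
proof -
  define g t where "g = gamma0_sq \<phi> (tanh v)" and "t = t0_sq \<phi> (tanh v)"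
  note pos = t0_sq_tanh_pos[folded t_def] gamma0_sq_tanh_pos[folded g_def]
  have interior: "-1 < tanh u" "tanh u < 1" "-1 < tanh v" "tanh v < 1"
    using tanh_real_bounds[of u] tanh_real_bounds[of v] by auto
  have odds: "(1 - tanh u) / (1 + tanh u) = exp (- 2 * u)"
    "(1 + tanh u) / (1 - tanh u) = exp (2 * u)"
    using one_plus_tanh_div_one_minus_tanh[of u] one_plus_tanh_div_one_minus_tanh[of "- u"]
    by simp_all
  have "h_at \<phi> (tanh v) (tanh u) = ereal (- ((exp (- 2 * u) + g * exp (2 * u)) * (t / 2)))"
    using interior pos odds by (simp add: h_at_def h_gt_def flip: g_def t_def)
  also have "- ((exp (- 2 * u) + g * exp (2 * u)) * (t / 2))
      = - (exp (- 2 * u) * t + exp (2 * u) * (g * t)) / 2"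
    by (simp add: algebra_simps)
  also have "exp (- 2 * u) * t = exp (- (2 * (u - v))) * (tanh_deriv \<phi> (tanh v) / 2 - \<phi> (tanh v))"
    unfolding t_def t0_sq_tanh mult.assoc[symmetric] exp_add[symmetric]
    by (simp add: algebra_simps)
  also have "exp (2 * u) * (g * t) = - exp (2 * (u - v)) * (tanh_deriv \<phi> (tanh v) / 2 + \<phi> (tanh v))"
    unfolding g_def t_def gamma0_sq_times_t0_sq_tanh
    by (simp add: exp_add[symmetric] right_diff_distrib flip: mult.assoc)
  finally show ?thesis
    by (simp add: cosh_field_def sinh_field_def field_simps)
qed

lemma h_at_tanh_eq_tangent_minus:
  "h_at \<phi> (tanh v) (tanh u) = ereal (\<phi> (tanh v) + dphi \<phi> (tanh v) * (tanh u - tanh v)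
    - (sinh (u - v))\<^sup>2 * (- 2 * \<phi> (tanh v) - tanh u * tanh_deriv \<phi> (tanh v)))"
  unfolding h_at_tanh tanh_deriv_def tanh_tangent_identity ..

lemma h_at_tanh_endpoints:
  "h_at \<phi> (tanh v) 1 = - \<infinity>" "h_at \<phi> (tanh v) (-1) = - \<infinity>"
  using t0_sq_tanh_pos gamma0_sq_tanh_pos tanh_real_bounds[of v]
  by (simp_all add: h_at_def h_gt_def)

end

text \<open>Both boundary functions in terms of the distance \<open>u\<close> to the end point, given the value \<open>a\<close> and
  the outward slope \<open>m\<close> there.\<close>

definition endpoint_profile :: "real \<Rightarrow> real \<Rightarrow> real \<Rightarrow> ereal" where
  "endpoint_profile a m u = - (ereal u / ereal (2 - u) * ereal (2 * max m 0)) + ereal a"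

lemma h_at_one: "h_at \<phi> 1 r = endpoint_profile (\<phi> 1) (dphi \<phi> 1) (1 - r)"
  by (simp add: h_at_def h_plus1_def endpoint_profile_def)

lemma h_at_minus_one: "h_at \<phi> (-1) r = endpoint_profile (\<phi> (-1)) (- dphi \<phi> (-1)) (1 + r)"
  by (simp add: h_at_def h_minus1_def endpoint_profile_def)

lemma endpoint_profile_le_tangent:
  assumes u: "0 \<le> u" "u \<le> 2"
  shows "endpoint_profile a m u \<le> ereal (a - m * u)"
proof (cases "u = 2")
  case True
  then show ?thesis
    by (cases "m \<le> 0") (simp_all add: endpoint_profile_def max_def)
next
  case False
  have "m * u \<le> 2 * max m 0 * (u / 2)"
    using u by (simp add: mult_right_mono)
  also have "\<dots> \<le> 2 * max m 0 * (u / (2 - u))"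
    using u False by (intro mult_left_mono divide_left_mono) auto
  finally show ?thesis
    using u False by (simp add: endpoint_profile_def mult.commute)
qed

lemma endpoint_profile_ge:
  assumes u: "0 \<le> u" "u \<le> 1" and m: "m \<le> L" "0 \<le> L"
  shows "ereal (a - 2 * L * u) \<le> endpoint_profile a m u"
proof -
  have "u / (2 - u) * (2 * max m 0) \<le> u / 1 * (2 * L)"
    using u m by (intro mult_mono divide_left_mono) auto
  then show ?thesis
    using u by (simp add: endpoint_profile_def mult.commute)
qed

subsection \<open>Comparison with a convex function\<close>

locale convex_profile =
  fixes \<phi> :: "real \<Rightarrow> real"
  assumes convex: "convex_on {-1..1} \<phi>"
    and nonpos: "\<And>r. r \<in> {-1..1} \<Longrightarrow> \<phi> r \<le> 0"
    and nonconst: "\<not> \<phi> constant_on {-1..1}"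
    and differentiable: "\<phi> differentiable_on {-1..1}"
begin

abbreviation "\<phi>' \<equiv> dphi \<phi>"

lemma has_real_derivative_dphi:
  assumes "r \<in> {-1..1}"
  shows "(\<phi> has_real_derivative \<phi>' r) (at r within {-1..1})"
  using assms differentiable unfolding dphi_def differentiable_on_def
  by (auto simp: vector_derivative_works has_real_derivative_iff_has_vector_derivative)

lemma tangent_le: "s \<in> {-1..1} \<Longrightarrow> r \<in> {-1..1} \<Longrightarrow> \<phi> s + \<phi>' s * (r - s) \<le> \<phi> r"
  using convex_on_imp_above_tangent_within[OF convex] has_real_derivative_dphi
  by (simp add: has_field_derivative_def)

lemma mono_on_dphi: "mono_on {-1..1} \<phi>'"
  using convex has_real_derivative_dphi by (rule convex_on_imp_mono_on_derivative)

lemma interior_neg: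
  assumes "-1 < s" "s < 1"
  shows "\<phi> s < 0"
proof (rule ccontr)
  assume "\<not> \<phi> s < 0"
  then have zero: "\<phi> s = 0"
    using nonpos[of s] assms by simp
  then have "\<phi>' s * (1 - s) \<le> 0" "\<phi>' s * (-1 - s) \<le> 0"
    using tangent_le[of s 1] tangent_le[of s "-1"] nonpos[of 1] nonpos[of "-1"] assms by auto
  then have "\<phi>' s = 0"
    using assms by (auto simp: mult_le_0_iff)
  then have "\<phi> x = 0" if "x \<in> {-1..1}" for x
    using tangent_le[of s x] nonpos[of x] assms zero that by force
  then show False
    using nonconst unfolding constant_on_def by blast
qed

text \<open>This holds because the tangent at \<open>s\<close> is nonpositive at both end points.\<close>

lemma abs_tanh_deriv_less:
  assumes s: "-1 < s" "s < 1"
  shows "\<bar>tanh_deriv \<phi> s\<bar> < - 2 * \<phi> s"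
proof -
  have scaled: "w * p < - 2 * \<phi> s" if "p \<le> - \<phi> s" "0 < w" "w < 2" for p w
  proof -
    have "w * p \<le> w * (- \<phi> s)"
      using that by (intro mult_left_mono) auto
    also have "\<dots> < 2 * (- \<phi> s)"
      using that interior_neg[OF s] by (intro mult_strict_right_mono) auto
    finally show ?thesis by simp
  qed
  have "\<phi>' s * (1 - s) \<le> - \<phi> s" "- \<phi>' s * (1 + s) \<le> - \<phi> s"
    using tangent_le[of s 1] tangent_le[of s "-1"] nonpos[of 1] nonpos[of "-1"] s
    by (auto simp: algebra_simps)
  then have "(1 + s) * (\<phi>' s * (1 - s)) < - 2 * \<phi> s" "(1 - s) * (- \<phi>' s * (1 + s)) < - 2 * \<phi> s"
    using s by (intro scaled; simp)+
  moreover have "tanh_deriv \<phi> s = (1 + s) * (\<phi>' s * (1 - s))"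
    "- tanh_deriv \<phi> s = (1 - s) * (- \<phi>' s * (1 + s))"
    by (simp_all add: tanh_deriv_def algebra_simps power2_eq_square)
  ultimately show ?thesis
    by (metis abs_less_iff)
qed

lemma abs_tanh_deriv_tanh_less: "\<bar>tanh_deriv \<phi> (tanh v)\<bar> < - 2 * \<phi> (tanh v)"
  using tanh_real_bounds[of v] by (intro abs_tanh_deriv_less) auto

lemma h_at_tanh_le:
  assumes r: "r \<in> {-1..1}"
  shows "h_at \<phi> (tanh v) r \<le> ereal (\<phi> r)"
proof (cases "\<bar>r\<bar> = 1")
  case True
  then have "r = 1 \<or> r = -1" by auto
  then show ?thesis
    using h_at_tanh_endpoints[OF abs_tanh_deriv_tanh_less, of v] by auto
next
  case False
  define u where "u = artanh r"
  have "\<bar>r\<bar> < 1"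
    using r False by auto
  then have u: "r = tanh u"
    unfolding u_def by (simp add: tanh_artanh_real)
  have "tanh u * tanh_deriv \<phi> (tanh v) \<le> \<bar>r\<bar> * \<bar>tanh_deriv \<phi> (tanh v)\<bar>"
    unfolding u abs_mult[symmetric] by (rule abs_ge_self)
  also have "\<dots> \<le> 1 * \<bar>tanh_deriv \<phi> (tanh v)\<bar>"
    using \<open>\<bar>r\<bar> < 1\<close> by (intro mult_right_mono) auto
  finally have "0 \<le> (sinh (u - v))\<^sup>2 * (- 2 * \<phi> (tanh v) - tanh u * tanh_deriv \<phi> (tanh v))"
    using abs_tanh_deriv_tanh_less[of v] by simp
  then show ?thesis
    using h_at_tanh_eq_tangent_minus[OF abs_tanh_deriv_tanh_less, of v u]
      tangent_le[OF tanh_real_in_Icc r, of v] unfolding u by simp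
qed

lemma h_at_le:
  assumes s: "s \<in> {-1..1}" and r: "r \<in> {-1..1}"
  shows "h_at \<phi> s r \<le> ereal (\<phi> r)"
proof -
  consider "s = 1" | "s = -1" | "\<bar>s\<bar> < 1"
    using s by force
  then show ?thesis
  proof cases
    case 1
    have "h_at \<phi> 1 r \<le> ereal (\<phi> 1 - \<phi>' 1 * (1 - r))"
      unfolding h_at_one using r by (intro endpoint_profile_le_tangent) auto
    also have "\<dots> \<le> ereal (\<phi> r)"
      using tangent_le[of 1 r] r by (simp add: algebra_simps)
    finally show ?thesis
      using 1 by simp
  next
    case 2
    have "h_at \<phi> (-1) r \<le> ereal (\<phi> (-1) - - \<phi>' (-1) * (1 + r))"
      unfolding h_at_minus_one using r by (intro endpoint_profile_le_tangent) auto
    also have "\<dots> \<le> ereal (\<phi> r)"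
      using tangent_le[of "-1" r] r by (simp add: algebra_simps)
    finally show ?thesis
      using 2 by simp
  next
    case 3
    then show ?thesis
      using h_at_tanh_le[OF r, of "artanh s"] by (simp add: tanh_artanh_real)
  qed
qed

end

locale lipschitz_convex_profile = convex_profile +
  fixes L M :: real
  assumes lipschitz: "L-lipschitz_on {-1..1} \<phi>"
    and bound: "\<And>r. r \<in> {-1..1} \<Longrightarrow> \<bar>\<phi> r\<bar> \<le> M"
begin

lemma L_pos: "0 < L"
proof (rule ccontr)
  assume "\<not> 0 < L"
  then have "L = 0"
    using lipschitz_on_nonneg[OF lipschitz] by simp
  then have "\<phi> x = \<phi> 0" if "x \<in> {-1..1}" for x
    using lipschitz_onD[OF lipschitz that, of 0] by simp
  then show False
    using nonconst unfolding constant_on_def by blast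
qed

lemma M_nonneg: "0 \<le> M"
  using bound[of 0] by simp

lemma abs_dphi_le:
  assumes "r \<in> {-1..1}"
  shows "\<bar>\<phi>' r\<bar> \<le> L"
proof -
  obtain y :: real where y: "y \<in> {-1..1}" "y \<noteq> r"
    by (rule that[of "if r = 1 then 0 else 1"]) auto
  have "\<bar>\<phi>' r * (y - r)\<bar> \<le> L * norm (y - r)"
    using lipschitz_on_has_derivative_le[OF lipschitz] has_real_derivative_dphi assms y(1)
    by (simp add: has_field_derivative_def convex_real_interval)
  then show ?thesis
    using y(2) by (simp add: abs_mult)
qed

lemma h_at_tanh_ge:
  assumes u: "\<bar>u - v\<bar> \<le> \<delta>" "\<delta> \<le> 1" and slope: "\<bar>\<phi>' (tanh u) - \<phi>' (tanh v)\<bar> \<le> \<eta>"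
  shows "ereal (\<phi> (tanh u) - (\<delta> * \<eta> + 4 * \<delta>\<^sup>2 * (2 * M + L))) \<le> h_at \<phi> (tanh v) (tanh u)"
proof -
  define r s where "r = tanh u" and "s = tanh v"
  have I: "r \<in> {-1..1}" "s \<in> {-1..1}"
    unfolding r_def s_def by (rule tanh_real_in_Icc)+
  have "\<phi> r - (\<phi> s + \<phi>' s * (r - s)) \<le> (r - s) * (\<phi>' r - \<phi>' s)"
    using tangent_le[OF I] by (simp add: algebra_simps)
  also have "\<dots> \<le> \<bar>r - s\<bar> * \<bar>\<phi>' r - \<phi>' s\<bar>"
    by (metis abs_ge_self abs_mult)
  also have "\<dots> \<le> \<delta> * \<eta>"
    using abs_tanh_diff_le[of u v] u(1) slope unfolding r_def s_def by (intro mult_mono) auto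
  finally have tangent: "\<phi> r - (\<phi> s + \<phi>' s * (r - s)) \<le> \<delta> * \<eta>" .
  have sinh_sq: "(sinh (u - v))\<^sup>2 \<le> 4 * \<delta>\<^sup>2"
    using power_mono[OF order_trans[OF abs_sinh_le_double], of "u - v" "2 * \<delta>" 2] u
    by (simp add: power_mult_distrib)
  have "\<bar>r * tanh_deriv \<phi> s\<bar> \<le> 1 * (1 * L)"
    unfolding tanh_deriv_def abs_mult using I abs_dphi_le[OF I(2)] L_pos
    by (intro mult_mono) (auto simp: abs_square_le_1 abs_le_iff)
  then have "- 2 * \<phi> s - r * tanh_deriv \<phi> s \<le> 2 * M + L"
    using bound[OF I(2)] by linarith
  then have "(sinh (u - v))\<^sup>2 * (- 2 * \<phi> s - r * tanh_deriv \<phi> s) \<le> (sinh (u - v))\<^sup>2 * (2 * M + L)"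
    by (intro mult_left_mono) auto
  also have "\<dots> \<le> 4 * \<delta>\<^sup>2 * (2 * M + L)"
    using sinh_sq L_pos M_nonneg by (intro mult_right_mono) auto
  finally show ?thesis
    using tangent unfolding h_at_tanh_eq_tangent_minus[OF abs_tanh_deriv_tanh_less] r_def s_def
    by simp
qed

lemma h_at_one_ge:
  assumes "0 \<le> r" "r \<le> 1"
  shows "ereal (\<phi> r - 3 * L * (1 - r)) \<le> h_at \<phi> 1 r"
proof -
  have "\<phi> r - \<phi> 1 \<le> L * (1 - r)"
    using lipschitz_onD[OF lipschitz, of r 1] assms by (simp add: dist_real_def)
  then have "ereal (\<phi> r - 3 * L * (1 - r)) \<le> ereal (\<phi> 1 - 2 * L * (1 - r))"
    by (simp add: algebra_simps)
  also have "\<dots> \<le> h_at \<phi> 1 r"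
    unfolding h_at_one using assms abs_dphi_le[of 1] L_pos by (intro endpoint_profile_ge) auto
  finally show ?thesis .
qed

lemma h_at_minus_one_ge:
  assumes "-1 \<le> r" "r \<le> 0"
  shows "ereal (\<phi> r - 3 * L * (1 + r)) \<le> h_at \<phi> (-1) r"
proof -
  have "\<phi> r - \<phi> (-1) \<le> L * (1 + r)"
    using lipschitz_onD[OF lipschitz, of r "-1"] assms by (simp add: dist_real_def add.commute)
  then have "ereal (\<phi> r - 3 * L * (1 + r)) \<le> ereal (\<phi> (-1) - 2 * L * (1 + r))"
    by (simp add: algebra_simps)
  also have "\<dots> \<le> h_at \<phi> (-1) r"
    unfolding h_at_minus_one using assms abs_dphi_le[of "-1"] L_pos
    by (intro endpoint_profile_ge) auto
  finally show ?thesis .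
qed

lemma exists_interior_net:
  assumes "0 \<le> A" "0 < \<delta>" "\<delta> \<le> 1" "0 < \<eta>"
  obtains T where "finite T" "real (card T) \<le> 2 * A / \<delta> + 2 * L / \<eta> + 1"
    "\<And>u. \<bar>u\<bar> \<le> A \<Longrightarrow> \<exists>v\<in>T.
      ereal (\<phi> (tanh u) - (\<delta> * \<eta> + 4 * \<delta>\<^sup>2 * (2 * M + L))) \<le> h_at \<phi> (tanh v) (tanh u)"
proof -
  obtain T where T: "T \<subseteq> {-A..A}" "finite T" "real (card T) \<le> (A - - A) / \<delta> + (L - - L) / \<eta> + 1"
    "\<And>u. u \<in> {-A..A} \<Longrightarrow> \<exists>v\<in>T. \<bar>u - v\<bar> \<le> \<delta> \<and> \<bar>\<phi>' (tanh u) - \<phi>' (tanh v)\<bar> \<le> \<eta>"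
  proof (rule finite_net_mono_on[where f = "\<lambda>u. u" and g = "\<lambda>u. \<phi>' (tanh u)"
        and \<delta> = \<delta> and \<eta> = \<eta>])
    show "mono_on {-A..A} (\<lambda>u. \<phi>' (tanh u))"
      using mono_onD[OF mono_on_dphi tanh_real_in_Icc tanh_real_in_Icc] by (intro mono_onI) simp
    show "\<phi>' (tanh u) \<in> {-L..L}" for u
      using abs_dphi_le[OF tanh_real_in_Icc, of u] by (simp add: abs_le_iff minus_le_iff)
    show "mono_on {-A..A} (\<lambda>u. u)"
      by (rule mono_onI)
    show "- A \<le> A" "- L \<le> L"
      using assms(1) L_pos by auto
  qed (use assms in \<open>auto intro: that\<close>)
  show ?thesis
  proof
    show "finite T" by (rule T(2))
    show "real (card T) \<le> 2 * A / \<delta> + 2 * L / \<eta> + 1"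
      using T(3) by simp
    fix u assume "\<bar>u\<bar> \<le> A"
    then show "\<exists>v\<in>T.
      ereal (\<phi> (tanh u) - (\<delta> * \<eta> + 4 * \<delta>\<^sup>2 * (2 * M + L))) \<le> h_at \<phi> (tanh v) (tanh u)"
      using T(4)[of u] h_at_tanh_ge[OF _ assms(3)] by (auto simp: abs_le_iff)
  qed
qed

lemma h_at_near_endpoints_ge:
  assumes \<epsilon>: "0 < \<epsilon>" "3 \<le> L / \<epsilon>" and r: "r \<in> {-1..1}" "tanh (ln (L / \<epsilon>)) < \<bar>r\<bar>"
  shows "\<exists>s\<in>{1, -1}. ereal (\<phi> r - 2 * \<epsilon>) \<le> h_at \<phi> s r"
proof -
  define x where "x = L / \<epsilon>"
  have x: "3 \<le> x"
    using \<epsilon>(2) unfolding x_def .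
  have "3 * x \<le> x * x"
    using x by (intro mult_right_mono) auto
  then have "3 * x \<le> x\<^sup>2 + 1"
    unfolding power2_eq_square by linarith
  then have "3 * x * (1 - \<bar>r\<bar>) \<le> (x\<^sup>2 + 1) * (1 - \<bar>r\<bar>)"
    using r(1) by (intro mult_right_mono) auto
  also have "1 - \<bar>r\<bar> \<le> 2 / (x\<^sup>2 + 1)"
    using r(2) x one_minus_tanh_ln[of x] unfolding x_def by linarith
  then have "(x\<^sup>2 + 1) * (1 - \<bar>r\<bar>) \<le> 2"
    using x by (simp add: pos_le_divide_eq add_pos_pos mult.commute)
  finally have "ereal (\<phi> r - 2 * \<epsilon>) \<le> ereal (\<phi> r - 3 * L * (1 - \<bar>r\<bar>))"
    using \<epsilon>(1) unfolding x_def by (simp add: field_simps)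
  moreover have "\<exists>s\<in>{1, -1}. ereal (\<phi> r - 3 * L * (1 - \<bar>r\<bar>)) \<le> h_at \<phi> s r"
    using h_at_one_ge[of r] h_at_minus_one_ge[of r] r(1) by (cases "0 \<le> r") auto
  ultimately show ?thesis
    using order_trans by blast
qed

lemma exists_interior_approximating_set:
  assumes \<epsilon>: "0 < \<epsilon>" "\<epsilon> \<le> L" and "0 \<le> A"
  obtains T where "finite T"
    "real (card T) \<le> 4 * sqrt (1 + 2 * (M / L)) * sqrt (L / \<epsilon>) * A + sqrt (L / \<epsilon>) + 1"
    "\<And>u. \<bar>u\<bar> \<le> A \<Longrightarrow> \<exists>v\<in>T. ereal (\<phi> (tanh u) - 2 * \<epsilon>) \<le> h_at \<phi> (tanh v) (tanh u)"
proof -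
  define x where "x = L / \<epsilon>"
  define \<kappa> where "\<kappa> = 1 + 2 * (M / L)"
  define \<delta> where "\<delta> = 1 / (2 * sqrt \<kappa> * sqrt x)"
  have x: "1 \<le> x" and \<kappa>: "1 \<le> \<kappa>"
    using \<epsilon> L_pos M_nonneg unfolding x_def \<kappa>_def by auto
  have "1 \<le> sqrt \<kappa> * sqrt x"
    using x \<kappa> mult_mono[of 1 "sqrt \<kappa>" 1 "sqrt x"] by auto
  then have \<delta>: "0 < \<delta>" "\<delta> \<le> 1"
    unfolding \<delta>_def by (auto simp: divide_simps)
  have "0 < \<epsilon> / \<delta>"
    using \<epsilon>(1) \<delta>(1) by simp
  then obtain T where T: "finite T" "real (card T) \<le> 2 * A / \<delta> + 2 * L / (\<epsilon> / \<delta>) + 1"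
    "\<And>u. \<bar>u\<bar> \<le> A \<Longrightarrow> \<exists>v\<in>T.
      ereal (\<phi> (tanh u) - (\<delta> * (\<epsilon> / \<delta>) + 4 * \<delta>\<^sup>2 * (2 * M + L))) \<le> h_at \<phi> (tanh v) (tanh u)"
    using exists_interior_net[OF \<open>0 \<le> A\<close> \<delta>] by metis
  show ?thesis
  proof
    have "2 * A / \<delta> = 4 * sqrt \<kappa> * sqrt x * A"
      unfolding \<delta>_def by simp
    moreover have "2 * L / (\<epsilon> / \<delta>) = x / sqrt x / sqrt \<kappa>"
      unfolding \<delta>_def x_def by (simp add: mult.commute)
    moreover have "x / sqrt x / sqrt \<kappa> \<le> sqrt x"
      using x \<kappa> by (simp add: real_div_sqrt divide_le_eq)
    ultimately show "real (card T)
        \<le> 4 * sqrt (1 + 2 * (M / L)) * sqrt (L / \<epsilon>) * A + sqrt (L / \<epsilon>) + 1"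
      using T(2) unfolding x_def \<kappa>_def by linarith
    have "2 * M + L = \<kappa> * L"
      using L_pos by (simp add: \<kappa>_def field_simps)
    moreover have "4 * \<delta>\<^sup>2 = 1 / (\<kappa> * x)"
      using x \<kappa> by (simp add: \<delta>_def power_divide power_mult_distrib)
    ultimately have error: "\<delta> * (\<epsilon> / \<delta>) + 4 * \<delta>\<^sup>2 * (2 * M + L) = 2 * \<epsilon>"
      using \<delta>(1) \<kappa> \<epsilon>(1) L_pos by (simp add: x_def)
    show "\<exists>v\<in>T. ereal (\<phi> (tanh u) - 2 * \<epsilon>) \<le> h_at \<phi> (tanh v) (tanh u)" if "\<bar>u\<bar> \<le> A" for u
      using T(3)[OF that] unfolding error .
  qed (rule T(1))
qed

lemma h_at_ge_of_interior_approximating_set: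
  assumes \<epsilon>: "0 < \<epsilon>" "3 \<le> L / \<epsilon>"
    and T: "\<And>u. \<bar>u\<bar> \<le> ln (L / \<epsilon>) \<Longrightarrow>
      \<exists>v\<in>T. ereal (\<phi> (tanh u) - 2 * \<epsilon>) \<le> h_at \<phi> (tanh v) (tanh u)"
    and r: "r \<in> {-1..1}"
  shows "\<exists>s\<in>{1, -1} \<union> tanh ` T. ereal (\<phi> r - 2 * \<epsilon>) \<le> h_at \<phi> s r"
proof (cases "tanh (ln (L / \<epsilon>)) < \<bar>r\<bar>")
  case True
  then show ?thesis
    using h_at_near_endpoints_ge[OF \<epsilon> r] by blast
next
  case False
  then have "\<bar>r\<bar> < 1"
    using tanh_real_lt_1[of "ln (L / \<epsilon>)"] by linarith
  then obtain u where u: "r = tanh u"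
    by (metis tanh_artanh_real)
  then have "tanh \<bar>u\<bar> \<le> tanh (ln (L / \<epsilon>))"
    using False by simp
  then have "\<bar>u\<bar> \<le> ln (L / \<epsilon>)"
    by (simp only: tanh_real_le_iff)
  then show ?thesis
    using T[of u] unfolding u by blast
qed

lemma exists_approximating_set_of_small_error:
  assumes \<epsilon>: "0 < \<epsilon>" "3 \<le> L / \<epsilon>"
  obtains T where "T \<subseteq> {-1..1}" "finite T"
    "real (card T) \<le> (4 + 4 * sqrt (1 + 2 * (M / L))) * (sqrt (L / \<epsilon>) * ln (L / \<epsilon>))"
    "\<And>r. r \<in> {-1..1} \<Longrightarrow> \<exists>s\<in>T. ereal (\<phi> r - 2 * \<epsilon>) \<le> h_at \<phi> s r"
proof -
  define x where "x = L / \<epsilon>"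
  define \<kappa> where "\<kappa> = 1 + 2 * (M / L)"
  have x: "3 \<le> x"
    using \<epsilon>(2) unfolding x_def .
  have ln_x: "1 \<le> ln x"
    using x e_less_272 by (subst ln_ge_iff) auto
  have "\<epsilon> \<le> L" "0 \<le> ln x"
    using \<epsilon> ln_x by (auto simp: field_simps)
  then obtain T where T: "finite T" "real (card T) \<le> 4 * sqrt \<kappa> * sqrt x * ln x + sqrt x + 1"
    "\<And>u. \<bar>u\<bar> \<le> ln x \<Longrightarrow> \<exists>v\<in>T. ereal (\<phi> (tanh u) - 2 * \<epsilon>) \<le> h_at \<phi> (tanh v) (tanh u)"
    using exists_interior_approximating_set[OF \<epsilon>(1)] unfolding x_def \<kappa>_def by metis
  show ?thesis
  proof
    show "{1, -1} \<union> tanh ` T \<subseteq> {-1..1}"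
      using tanh_real_in_Icc by auto
    show "finite ({1, -1} \<union> tanh ` T)"
      using T(1) by simp
    have "card ({1, -1} \<union> tanh ` T) \<le> card {1, -1 :: real} + card (tanh ` T)"
      by (rule card_Un_le)
    also have "\<dots> \<le> 2 + card T"
      using T(1) by (simp add: card_image_le)
    finally have "real (card ({1, -1} \<union> tanh ` T)) \<le> 4 * sqrt \<kappa> * sqrt x * ln x + sqrt x + 3"
      using T(2) by linarith
    also have "\<dots> \<le> 4 * sqrt \<kappa> * sqrt x * ln x + 4 * (sqrt x * ln x)"
    proof -
      have "1 \<le> sqrt x" "sqrt x \<le> sqrt x * ln x"
        using x ln_x by simp_all
      then show ?thesis by linarith
    qed
    finally show "real (card ({1, -1} \<union> tanh ` T))
        \<le> (4 + 4 * sqrt (1 + 2 * (M / L))) * (sqrt (L / \<epsilon>) * ln (L / \<epsilon>))"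
      unfolding x_def \<kappa>_def by (simp add: algebra_simps)
    show "\<exists>s\<in>{1, -1} \<union> tanh ` T. ereal (\<phi> r - 2 * \<epsilon>) \<le> h_at \<phi> s r" if "r \<in> {-1..1}" for r
      using \<epsilon> T(3)[unfolded x_def] that by (rule h_at_ge_of_interior_approximating_set)
  qed
qed

lemma exists_approximating_set:
  assumes "0 < \<epsilon>"
  shows "\<exists>T\<subseteq>{-1..1}. finite T \<and>
    (3 \<le> L / \<epsilon> \<longrightarrow>
      real (card T) \<le> (4 + 4 * sqrt (1 + 2 * (M / L))) * (sqrt (L / \<epsilon>) * ln (L / \<epsilon>))) \<and>
    (\<forall>r\<in>{-1..1}. 0 \<le> ereal (\<phi> r) - (SUP s\<in>T. h_at \<phi> s r) \<and>
      ereal (\<phi> r) - (SUP s\<in>T. h_at \<phi> s r) \<le> ereal (2 * \<epsilon>))"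
proof -
  define \<epsilon>' where "\<epsilon>' = min \<epsilon> (L / 3)"
  have "0 < \<epsilon>'" "3 \<le> L / \<epsilon>'"
    using assms L_pos unfolding \<epsilon>'_def by (auto simp: min_def field_simps)
  then obtain T where T: "T \<subseteq> {-1..1}" "finite T"
    "real (card T) \<le> (4 + 4 * sqrt (1 + 2 * (M / L))) * (sqrt (L / \<epsilon>') * ln (L / \<epsilon>'))"
    "\<And>r. r \<in> {-1..1} \<Longrightarrow> \<exists>s\<in>T. ereal (\<phi> r - 2 * \<epsilon>') \<le> h_at \<phi> s r"
    using exists_approximating_set_of_small_error by metis
  show ?thesis
  proof (intro exI[of _ T] conjI impI ballI T(1,2))
    assume "3 \<le> L / \<epsilon>"
    then have "\<epsilon>' = \<epsilon>"
      using assms unfolding \<epsilon>'_def by (simp add: field_simps)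
    then show "real (card T) \<le> (4 + 4 * sqrt (1 + 2 * (M / L))) * (sqrt (L / \<epsilon>) * ln (L / \<epsilon>))"
      using T(3) by simp
  next
    fix r :: real assume r: "r \<in> {-1..1}"
    have upper: "h_at \<phi> s r \<le> ereal (\<phi> r)" if "s \<in> T" for s
      using h_at_le[OF _ r] T(1) that by blast
    have "ereal (\<phi> r - 2 * \<epsilon>) \<le> ereal (\<phi> r - 2 * \<epsilon>')"
      unfolding \<epsilon>'_def by simp
    then have lower: "\<exists>s\<in>T. ereal (\<phi> r - 2 * \<epsilon>) \<le> h_at \<phi> s r"
      using T(4)[OF r] order_trans by blast
    show "0 \<le> ereal (\<phi> r) - (SUP s\<in>T. h_at \<phi> s r)"
      "ereal (\<phi> r) - (SUP s\<in>T. h_at \<phi> s r) \<le> ereal (2 * \<epsilon>)"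
      by (rule ereal_minus_SUP_bounds[OF upper lower]; assumption)+
  qed
qed

end

lemma lipschitz_convex_profile_lip_const:
  assumes "convex_on {-1..1} \<phi>" "\<forall>r\<in>{-1..1}. \<phi> r \<le> 0" "\<not> \<phi> constant_on {-1..1}"
    and differentiable: "\<phi> differentiable_on {-1..1}" and lipschitz: "\<exists>L. L-lipschitz_on {-1..1} \<phi>"
  shows "lipschitz_convex_profile \<phi> (lip_const \<phi>) (SUP r\<in>{-1..1}. \<bar>\<phi> r\<bar>)"
proof
  show "(lip_const \<phi>)-lipschitz_on {-1..1} \<phi>"
    unfolding lip_const_def using lipschitz by (rule lipschitz_on_Inf)
  have "continuous_on {-1..1} (\<lambda>r. \<bar>\<phi> r\<bar>)"
    using differentiable_imp_continuous_on[OF differentiable] by (intro continuous_intros)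
  then have "bdd_above ((\<lambda>r. \<bar>\<phi> r\<bar>) ` {-1..1})"
    by (intro bounded_imp_bdd_above compact_imp_bounded compact_continuous_image) auto
  then show "\<bar>\<phi> r\<bar> \<le> (SUP r\<in>{-1..1}. \<bar>\<phi> r\<bar>)" if "r \<in> {-1..1}" for r
    using that by (rule cSUP_upper[rotated])
qed (use assms in auto)

theorem theorem7:
  "\<exists>(C :: real \<Rightarrow> real) (x\<^sub>0 :: real). mono C \<and>
     (\<forall>(\<phi> :: real \<Rightarrow> real) (\<epsilon> :: real).
        convex_on {-1..1} \<phi> \<longrightarrow>
        (\<forall>\<rho>\<in>{-1..1}. \<phi> \<rho> \<le> 0) \<longrightarrow>
        \<not> \<phi> constant_on {-1..1} \<longrightarrow>
        \<phi> differentiable_on {-1..1} \<longrightarrow>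
        (\<exists>L. L-lipschitz_on {-1..1} \<phi>) \<longrightarrow>
        \<epsilon> > 0 \<longrightarrow>
        (\<exists>T \<subseteq> {-1..1}.
           finite T \<and>
           (lip_const \<phi> / \<epsilon> \<ge> x\<^sub>0 \<longrightarrow>
              real (card T) \<le> C ((SUP \<rho>\<in>{-1..1}. \<bar>\<phi> \<rho>\<bar>) / lip_const \<phi>) *
                (sqrt (lip_const \<phi> / \<epsilon>) * ln (lip_const \<phi> / \<epsilon>))) \<and>
           (\<forall>\<rho>\<in>{-1..1}.
              0 \<le> ereal (\<phi> \<rho>) - (SUP \<rho>\<^sub>0\<in>T. h_at \<phi> \<rho>\<^sub>0 \<rho>) \<and>
              ereal (\<phi> \<rho>) - (SUP \<rho>\<^sub>0\<in>T. h_at \<phi> \<rho>\<^sub>0 \<rho>) \<le> ereal (2 * \<epsilon>))))"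
proof (intro exI[of _ "\<lambda>m. 4 + 4 * sqrt (1 + 2 * m)"] exI[of _ 3] conjI allI impI)
  show "mono (\<lambda>m::real. 4 + 4 * sqrt (1 + 2 * m))"
    by (rule monoI) simp
qed (rule lipschitz_convex_profile.exists_approximating_set[OF lipschitz_convex_profile_lip_const];
    assumption)

end
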